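(* Let $\mathbb{K}$ be a field. For $\nu\in\mathbb{K}^\times$ let $E_\nu$ be the evolution algebra over $\mathbb{K}$ with natural basis $\{e_1,e_2,e_3\}$ and multiplication determined by $e_ie_j=0$ for $i\neq j$ and $$e_1^2=-e_1-e_3,\qquad e_2^2=-2e_1+\nu e_2+(\nu-2)e_3,\qquad e_3^2=e_1+e_3.$$ Let $\lambda,\mu\in\mathbb{K}^\times$. Then $E_\lambda^2$ and $E_\mu^2$ are isomorphic as $\mathbb{K}$-algebras if and only if $\lambda=\mu$. Consequently, $E_\lambda$ and $E_\mu$ are isomorphic as $\mathbb{K}$-algebras if and only if $\lambda=\mu$.
   Context: An evolution algebra over a field $\mathbb{K}$ is a commutative, not necessarily associative, $\mathbb{K}$-algebra $E$ admitting a basis $\{e_1,\dots,e_n\}$ (called a natural basis) with $e_ie_j=0$ for all $i\ne j$. For an algebra $A$, $A^2$ denotes the linear span of all products $xy$ with $x,y\in A$; it is a subalgebra of $A$, regarded as an algebra with the induced multiplication. *)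

theory Defs
  imports "HOL-Analysis.Cartesian_Space"
begin

text \<open>An algebra over a field \<open>'k\<close> is carried by a subspace of an ambient vector space whose
  addition is that of the type class; this allows a subalgebra to be treated as an algebra in its
  own right. No associativity or unit is required.\<close>

record ('k, 'v) alg =
  Carrier :: "'v set"
  scal :: "'k \<Rightarrow> 'v \<Rightarrow> 'v"
  prd :: "'v \<Rightarrow> 'v \<Rightarrow> 'v"

definition algebra :: "('k::field, 'v::ab_group_add) alg \<Rightarrow> bool" where
  "algebra A \<longleftrightarrow>
     vector_space (scal A) \<and> module.subspace (scal A) (Carrier A) \<and>
     (\<forall>x\<in>Carrier A. \<forall>y\<in>Carrier A. prd A x y \<in> Carrier A) \<and>
     (\<forall>x\<in>Carrier A. \<forall>y\<in>Carrier A. \<forall>z\<in>Carrier A.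
        prd A (x + y) z = prd A x z + prd A y z \<and> prd A x (y + z) = prd A x y + prd A x z) \<and>
     (\<forall>c. \<forall>x\<in>Carrier A. \<forall>y\<in>Carrier A.
        prd A (scal A c x) y = scal A c (prd A x y) \<and> prd A x (scal A c y) = scal A c (prd A x y))"

definition alg_iso ::
  "('k::field, 'v::ab_group_add) alg \<Rightarrow> ('k, 'w::ab_group_add) alg \<Rightarrow> ('v \<Rightarrow> 'w) \<Rightarrow> bool" where
  "alg_iso A B f \<longleftrightarrow>
     bij_betw f (Carrier A) (Carrier B) \<and>
     (\<forall>x\<in>Carrier A. \<forall>y\<in>Carrier A. f (x + y) = f x + f y) \<and>
     (\<forall>c. \<forall>x\<in>Carrier A. f (scal A c x) = scal B c (f x)) \<and>
     (\<forall>x\<in>Carrier A. \<forall>y\<in>Carrier A. f (prd A x y) = prd B (f x) (f y))"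

definition isomorphic ::
  "('k::field, 'v::ab_group_add) alg \<Rightarrow> ('k, 'w::ab_group_add) alg \<Rightarrow> bool" where
  "isomorphic A B \<longleftrightarrow> (\<exists>f. alg_iso A B f)"

definition alg_square :: "('k::field, 'v::ab_group_add) alg \<Rightarrow> ('k, 'v) alg" where
  "alg_square A =
     A\<lparr>Carrier := module.span (scal A) {prd A x y | x y. x \<in> Carrier A \<and> y \<in> Carrier A}\<rparr>"

definition natural_basis :: "('k::field, 'v::ab_group_add) alg \<Rightarrow> 'v set \<Rightarrow> bool" where
  "natural_basis A B \<longleftrightarrow>
     finite B \<and> \<not> module.dependent (scal A) B \<and> module.span (scal A) B = Carrier A \<and>
     (\<forall>x\<in>B. \<forall>y\<in>B. x \<noteq> y \<longrightarrow> prd A x y = 0)"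

definition evolution_algebra :: "('k::field, 'v::ab_group_add) alg \<Rightarrow> bool" where
  "evolution_algebra A \<longleftrightarrow>
     algebra A \<and> (\<forall>x\<in>Carrier A. \<forall>y\<in>Carrier A. prd A x y = prd A y x) \<and>
     (\<exists>B. natural_basis A B)"

abbreviation e :: "'n::finite \<Rightarrow> 'k::field ^ 'n" where
  "e i \<equiv> axis i 1"

text \<open>The bilinear extension of \<open>e i * e i = s i\<close> and \<open>e i * e j = 0\<close> for \<open>i \<noteq> j\<close>.\<close>

definition evol_alg :: "('n::finite \<Rightarrow> 'k::field ^ 'n) \<Rightarrow> ('k, 'k ^ 'n) alg" where
  "evol_alg s =
     \<lparr>Carrier = UNIV, scal = (*s), prd = (\<lambda>x y. \<Sum>i\<in>UNIV. (x $ i * y $ i) *s s i)\<rparr>"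

definition E :: "'k::field \<Rightarrow> ('k, 'k ^ 3) alg" where
  "E \<nu> = evol_alg (\<lambda>i.
     if i = 1 then - e 1 - e 3
     else if i = 2 then - (2 *s e 1) + \<nu> *s e 2 + (\<nu> - 2) *s e 3
     else e 1 + e 3)"

lemma algebra_evol_alg: "algebra (evol_alg s)"
proof -
  have "(\<Sum>i\<in>UNIV. ((x + y) $ i * z $ i) *s s i) =
      (\<Sum>i\<in>UNIV. (x $ i * z $ i) *s s i) + (\<Sum>i\<in>UNIV. (y $ i * z $ i) *s s i)" for x y z
    by (simp add: distrib_right vec.scale_left_distrib sum.distrib)
  moreover have "(\<Sum>i\<in>UNIV. (x $ i * (y + z) $ i) *s s i) =
      (\<Sum>i\<in>UNIV. (x $ i * y $ i) *s s i) + (\<Sum>i\<in>UNIV. (x $ i * z $ i) *s s i)" for x y z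
    by (simp add: distrib_left vec.scale_left_distrib sum.distrib)
  moreover have "(\<Sum>i\<in>UNIV. ((c *s x) $ i * y $ i) *s s i) =
      c *s (\<Sum>i\<in>UNIV. (x $ i * y $ i) *s s i)" for c x y
    by (simp add: vec.scale_sum_right mult.assoc)
  moreover have "(\<Sum>i\<in>UNIV. (x $ i * (c *s y) $ i) *s s i) =
      c *s (\<Sum>i\<in>UNIV. (x $ i * y $ i) *s s i)" for c x y
    by (simp add: vec.scale_sum_right mult.left_commute)
  ultimately show ?thesis
    unfolding algebra_def evol_alg_def alg.simps
    using vec.vector_space_axioms vec.subspace_UNIV by blast
qed

lemma prd_evol_alg_basis: "prd (evol_alg s) (e i) (e j) = (if i = j then s i else 0)"
proof -
  have "prd (evol_alg s) (e i) (e j) = (\<Sum>k\<in>UNIV. if k = i then (if i = j then s i else 0) else 0)"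
    unfolding evol_alg_def alg.simps by (rule sum.cong) (simp_all add: axis_def)
  then show ?thesis by simp
qed

lemma natural_basis_evol_alg: "natural_basis (evol_alg s) (range e)"
proof -
  have *: "range e = (cart_basis :: ('k::field ^ 'n::finite) set)"
    by (auto simp: cart_basis_def)
  have "prd (evol_alg s) x y = 0" if "x \<in> range e" "y \<in> range e" "x \<noteq> y" for x y
    using that prd_evol_alg_basis[of s] by auto
  then show ?thesis
    unfolding natural_basis_def
    by (simp add: evol_alg_def * finite_cart_basis independent_cart_basis span_cart_basis)
qed

lemma evolution_algebra_evol_alg: "evolution_algebra (evol_alg s)"
proof -
  have "prd (evol_alg s) x y = prd (evol_alg s) y x" for x y
    unfolding evol_alg_def alg.simps by (simp only: mult.commute)
  then show ?thesis
    unfolding evolution_algebra_def using algebra_evol_alg natural_basis_evol_alg by blast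
qed

lemma evolution_algebra_E: "evolution_algebra (E \<nu>)"
  unfolding E_def by (rule evolution_algebra_evol_alg)

lemma natural_basis_E:
  fixes \<nu> :: "'k::field"
  shows "natural_basis (E \<nu>) {e 1, e 2, e 3}"
proof -
  have "range e = {e 1, e 2, e 3 :: 'k ^ 3}" by (simp add: UNIV_3)
  from this[symmetric] show ?thesis
    unfolding E_def by (rule ssubst) (rule natural_basis_evol_alg)
qed

lemma prd_E_basis:
  shows "i \<noteq> j \<Longrightarrow> prd (E \<nu>) (e i) (e j) = 0"
    and "prd (E \<nu>) (e 1) (e 1) = - e 1 - e 3"
    and "prd (E \<nu>) (e 2) (e 2) = - (2 *s e 1) + \<nu> *s e 2 + (\<nu> - 2) *s e 3"
    and "prd (E \<nu>) (e 3) (e 3) = e 1 + e 3"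
  unfolding E_def by (simp_all add: prd_evol_alg_basis)

lemma algebra_alg_square:
  assumes "algebra A"
  shows "algebra (alg_square A)"
proof -
  interpret vector_space "scal A" using assms by (simp add: algebra_def)
  define S where "S = span {prd A x y | x y. x \<in> Carrier A \<and> y \<in> Carrier A}"
  have S: "scal (alg_square A) = scal A" "prd (alg_square A) = prd A" "Carrier (alg_square A) = S"
    by (simp_all add: alg_square_def S_def)
  have sub: "S \<subseteq> Carrier A"
    unfolding S_def using assms by (intro span_minimal) (auto simp: algebra_def)
  have closed: "prd A x y \<in> S" if "x \<in> S" "y \<in> S" for x y
    unfolding S_def using that sub by (intro span_base) blast
  have "subspace S" by (simp add: S_def subspace_span)
  then show ?thesis
    unfolding algebra_def S
    using assms[unfolded algebra_def] sub closed by (intro conjI ballI allI) blast+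
qed

end

theory Submission
  imports Defs
begin

text \<open>For \<open>\<nu> \<noteq> 0\<close> the square of \<open>E \<nu>\<close> has basis \<open>u = e\<^sub>1 + e\<^sub>3\<close> and \<open>v = e\<^sub>2\<^sup>2\<close>, with \<open>u\<^sup>2 = 0\<close>,
  \<open>u v = \<nu> u\<close> and \<open>v\<^sup>2 = \<nu> (\<nu> - 4) u + \<nu>\<^sup>2 v\<close>. The line spanned by \<open>u\<close> consists of the elements of
  square zero, so an isomorphism maps \<open>u\<close> to a nonzero multiple of \<open>u\<close> and \<open>v\<close> to \<open>c u + d v\<close>.
  Comparing \<open>u v\<close> gives \<open>d m = l\<close>, comparing \<open>v\<^sup>2\<close> modulo \<open>u\<close> gives \<open>d m\<^sup>2 = l\<^sup>2\<close>, whence \<open>l = m\<close>.\<close>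

lemma isomorphic_refl: "isomorphic A A"
  unfolding isomorphic_def alg_iso_def by (rule exI[of _ id]) auto

lemma alg_square_simps [simp]:
  "scal (alg_square A) = scal A" "prd (alg_square A) = prd A"
  "Carrier (alg_square A) = module.span (scal A) {prd A x y | x y. x \<in> Carrier A \<and> y \<in> Carrier A}"
  by (simp_all add: alg_square_def)

text \<open>An isomorphism maps the set of products of \<open>A\<close> onto that of
  \<open>B\<close>, so by linearity it maps the span of the first onto the span of the second. This
  reduces the claim about the whole algebras to the one about their squares.\<close>

lemma alg_iso_alg_square:
  assumes A: "algebra A" and B: "algebra B" and f: "alg_iso A B f"
  shows "alg_iso (alg_square A) (alg_square B) f"
proof -
  interpret A: vector_space "scal A" using A by (simp add: algebra_def)
  interpret B: vector_space "scal B" using B by (simp add: algebra_def)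
  define S where "S = {prd A x y | x y. x \<in> Carrier A \<and> y \<in> Carrier A}"
  define T where "T = {prd B x y | x y. x \<in> Carrier B \<and> y \<in> Carrier B}"
  note iso = f[unfolded alg_iso_def]
  have add: "f (x + y) = f x + f y" if "x \<in> Carrier A" "y \<in> Carrier A" for x y
    using iso that by blast
  have scale: "f (scal A c x) = scal B c (f x)" if "x \<in> Carrier A" for c x
    using iso that by blast
  have mult: "f (prd A x y) = prd B (f x) (f y)" if "x \<in> Carrier A" "y \<in> Carrier A" for x y
    using iso that by blast
  have img: "f ` Carrier A = Carrier B" and inj: "inj_on f (Carrier A)"
    using iso by (auto simp: bij_betw_def)
  have subA: "A.subspace (Carrier A)" using A by (simp add: algebra_def)
  have sub: "A.span S \<subseteq> Carrier A"
    unfolding S_def using A by (intro A.span_minimal) (auto simp: algebra_def)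
  have f0: "f 0 = 0"
    using add[of 0 0] A.subspace_0[OF subA] by simp
  \<comment> \<open>First inclusion, through a preimage; it is cut down to \<open>Carrier A\<close>
    because \<open>f\<close> is linear only there.\<close>
  have "A.subspace {x \<in> Carrier A. f x \<in> B.span T}"
    by (rule A.subspaceI)
      (auto simp: add scale f0 A.subspace_0[OF subA] A.subspace_add[OF subA]
        A.subspace_scale[OF subA] B.span_zero B.span_add B.span_scale)
  moreover have "S \<subseteq> {x \<in> Carrier A. f x \<in> B.span T}"
  proof
    fix s assume "s \<in> S"
    then obtain x y where xy: "s = prd A x y" "x \<in> Carrier A" "y \<in> Carrier A"
      by (auto simp: S_def)
    have "f s \<in> T" unfolding T_def using xy mult img by blast
    moreover have "s \<in> Carrier A" using xy A by (simp add: algebra_def)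
    ultimately show "s \<in> {x \<in> Carrier A. f x \<in> B.span T}" by (simp add: B.span_base)
  qed
  ultimately have le: "A.span S \<subseteq> {x \<in> Carrier A. f x \<in> B.span T}"
    by (intro A.span_minimal)
  \<comment> \<open>Reverse inclusion: the image of a span is a subspace, and it contains
    \<open>T\<close> because \<open>f\<close> is onto \<open>Carrier B\<close>.\<close>
  have "B.subspace (f ` A.span S)"
  proof (rule B.subspaceI)
    show "0 \<in> f ` A.span S" using f0 A.span_zero by force
  next
    fix x y assume "x \<in> f ` A.span S" "y \<in> f ` A.span S"
    then obtain p q where pq: "p \<in> A.span S" "q \<in> A.span S" "x = f p" "y = f q" by blast
    then have "x + y = f (p + q)" using add[OF subsetD[OF sub] subsetD[OF sub]] by simp
    then show "x + y \<in> f ` A.span S" using pq A.span_add by blast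
  next
    fix c x assume "x \<in> f ` A.span S"
    then obtain p where p: "p \<in> A.span S" "x = f p" by blast
    then have "scal B c x = f (scal A c p)" using scale[OF subsetD[OF sub]] by simp
    then show "scal B c x \<in> f ` A.span S" using p A.span_scale by blast
  qed
  moreover have "T \<subseteq> f ` A.span S"
  proof
    fix t assume "t \<in> T"
    then obtain x y where "t = prd B (f x) (f y)" and xy: "x \<in> Carrier A" "y \<in> Carrier A"
      unfolding T_def img[symmetric] by blast
    then have "t = f (prd A x y)" by (simp add: mult)
    moreover have "prd A x y \<in> A.span S" unfolding S_def using xy by (intro A.span_base) blast
    ultimately show "t \<in> f ` A.span S" by blast
  qed
  ultimately have "B.span T \<subseteq> f ` A.span S" by (intro B.span_minimal)
  with le have "f ` A.span S = B.span T" by blast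
  then have "bij_betw f (A.span S) (B.span T)"
    using inj_on_subset[OF inj sub] by (simp add: bij_betw_def)
  then show ?thesis
    unfolding alg_iso_def alg_square_simps S_def[symmetric] T_def[symmetric]
    using add scale mult sub by (simp add: subset_iff)
qed

definition u :: "'k::field ^ 3" where
  "u = e 1 + e 3"

definition v :: "'k::field \<Rightarrow> 'k ^ 3" where
  "v \<nu> = - (2 *s e 1) + \<nu> *s e 2 + (\<nu> - 2) *s e 3"

lemma u_nth [simp]: "u $ 1 = 1" "u $ 2 = 0" "u $ 3 = 1"
  by (simp_all add: u_def axis_def)

lemma v_nth [simp]: "v \<nu> $ 1 = - 2" "v \<nu> $ 2 = \<nu>" "v \<nu> $ 3 = \<nu> - 2"
  by (simp_all add: v_def axis_def)

lemma scal_E [simp]: "scal (E \<nu>) = (*s)"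
  by (simp add: E_def evol_alg_def)

lemma Carrier_E [simp]: "Carrier (E \<nu>) = UNIV"
  by (simp add: E_def evol_alg_def)

text \<open>The squares of \<open>e 1\<close> and \<open>e 3\<close> are \<open>-u\<close> and
  \<open>u\<close>, so every product is a combination of \<open>u\<close> and \<open>v \<nu>\<close>
  alone.\<close>

lemma prd_E: "prd (E \<nu>) x y = (x $ 3 * y $ 3 - x $ 1 * y $ 1) *s u + (x $ 2 * y $ 2) *s v \<nu>"
proof -
  have "prd (E \<nu>) x y = (x $ 1 * y $ 1) *s (- e 1 - e 3) + (x $ 2 * y $ 2) *s v \<nu> + (x $ 3 * y $ 3) *s u"
    by (simp add: E_def evol_alg_def sum_3 u_def v_def)
  moreover have "- e 1 - e 3 = - (u :: 'a ^ 3)" by (simp add: u_def)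
  ultimately show ?thesis
    by (simp add: vec.scale_left_diff_distrib)
qed

lemma mem_alg_square_E_iff:
  "x \<in> Carrier (alg_square (E \<nu>)) \<longleftrightarrow> (\<exists>a b. x = a *s u + b *s v \<nu>)"
proof -
  have "Carrier (alg_square (E \<nu>)) = vec.span {u, v \<nu>}"
  proof
    have *: "a *s u + b *s v \<nu> \<in> vec.span {u, v \<nu>}" for a b
      by (intro vec.span_add vec.span_scale vec.span_base) simp_all
    show "Carrier (alg_square (E \<nu>)) \<subseteq> vec.span {u, v \<nu>}"
      unfolding alg_square_simps scal_E
    proof (rule vec.span_minimal)
      show "{prd (E \<nu>) x y | x y. x \<in> Carrier (E \<nu>) \<and> y \<in> Carrier (E \<nu>)} \<subseteq> vec.span {u, v \<nu>}"
        unfolding prd_E using * by blast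
    qed (rule vec.subspace_span)
  next
    have "u = prd (E \<nu>) (e 3) (e 3)" "v \<nu> = prd (E \<nu>) (e 2) (e 2)"
      by (simp_all add: prd_E_basis u_def v_def)
    then have "{u, v \<nu>} \<subseteq> {prd (E \<nu>) x y | x y. True}" by blast
    then show "vec.span {u, v \<nu>} \<subseteq> Carrier (alg_square (E \<nu>))"
      by (simp add: vec.span_mono)
  qed
  \<comment> \<open>The summands are swapped because \<open>x - a *s u = b *s v \<nu>\<close>
    rewrites to this order; commutativity restores the other one.\<close>
  moreover have "x \<in> vec.span {u, v \<nu>} \<longleftrightarrow> (\<exists>a b. x = b *s v \<nu> + a *s u)"
    unfolding vec.span_breakdown_eq[of x] vec.span_singleton by (simp only: image_iff diff_eq_eq bex_UNIV)
  ultimately show ?thesis by (simp only: add.commute)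
qed

lemma prd_E_uv:
  "prd (E \<nu>) (a *s u + b *s v \<nu>) (c *s u + d *s v \<nu>) =
     (\<nu> * (a * d + b * c) + \<nu> * (\<nu> - 4) * b * d) *s u + (\<nu>\<^sup>2 * b * d) *s v \<nu>"
proof -
  let ?x = "a *s u + b *s v \<nu>" and ?y = "c *s u + d *s v \<nu>"
  \<comment> \<open>The factor \<open>\<nu> * (\<nu> - 4)\<close> is
    \<open>(\<nu> - 2)\<^sup>2 - (-2)\<^sup>2\<close>, from the outer coordinates of
    \<open>v \<nu>\<close>.\<close>
  have "?x $ 3 * ?y $ 3 - ?x $ 1 * ?y $ 1 = \<nu> * (a * d + b * c) + \<nu> * (\<nu> - 4) * b * d"
    unfolding vector_add_component vector_smult_component u_nth v_nth by (simp add: algebra_simps power2_eq_square)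
  moreover have "?x $ 2 * ?y $ 2 = \<nu>\<^sup>2 * b * d"
    unfolding vector_add_component vector_smult_component u_nth v_nth by (simp add: algebra_simps power2_eq_square)
  ultimately show ?thesis by (simp only: prd_E)
qed

text \<open>The second coordinate sees only \<open>v \<nu>\<close>, with factor
  \<open>\<nu>\<close>, and then the first one determines the coefficient of \<open>u\<close>. For
  \<open>\<nu> = 0\<close> the vector \<open>v \<nu>\<close> would be \<open>-2u\<close>.\<close>

lemma uv_eq_iff:
  assumes "\<nu> \<noteq> 0"
  shows "a *s u + b *s v \<nu> = c *s u + d *s v \<nu> \<longleftrightarrow> a = c \<and> b = d"
proof
  assume *: "a *s u + b *s v \<nu> = c *s u + d *s v \<nu>"
  have "b = d" using arg_cong[OF *, of "\<lambda>x. x $ 2"] assms by simp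
  moreover from this have "a = c" using arg_cong[OF *, of "\<lambda>x. x $ 1"] by simp
  ultimately show "a = c \<and> b = d" by simp
qed simp

lemma isomorphic_alg_square_E_imp_eq:
  assumes l: "l \<noteq> 0" and m: "m \<noteq> 0"
    and iso: "isomorphic (alg_square (E l)) (alg_square (E m))"
  shows "l = m"
proof -
  obtain f where f: "alg_iso (alg_square (E l)) (alg_square (E m)) f"
    using iso by (auto simp: isomorphic_def)
  let ?S = "Carrier (alg_square (E l))"
  let ?T = "Carrier (alg_square (E m))"
  have bij: "bij_betw f ?S ?T"
    and add: "\<And>x y. x \<in> ?S \<Longrightarrow> y \<in> ?S \<Longrightarrow> f (x + y) = f x + f y"
    and scale: "\<And>c x. x \<in> ?S \<Longrightarrow> f (c *s x) = c *s f x"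
    and mult: "\<And>x y. x \<in> ?S \<Longrightarrow> y \<in> ?S \<Longrightarrow> f (prd (E l) x y) = prd (E m) (f x) (f y)"
    using f unfolding alg_iso_def by (simp_all del: alg_square_simps(3))
  have mem: "a *s u + b *s v l \<in> ?S" for a b
    using mem_alg_square_E_iff by blast
  have uS: "u \<in> ?S" and vS: "v l \<in> ?S" and zS: "0 \<in> ?S"
    using mem[of 1 0] mem[of 0 1] mem[of 0 0] by simp_all
  have lin: "f (a *s u + b *s v l) = a *s f u + b *s f (v l)" for a b
    using add[of "a *s u" "b *s v l"] scale uS vS mem[of a 0] mem[of 0 b] by simp
  have f0: "f 0 = 0" using lin[of 0 0] by simp
  obtain a b where fu: "f u = a *s u + b *s v m"
    using bij uS mem_alg_square_E_iff by (metis bij_betwE)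
  obtain c d where fv: "f (v l) = c *s u + d *s v m"
    using bij vS mem_alg_square_E_iff by (metis bij_betwE)
  have "prd (E m) (f u) (f u) = 0"
    using mult[OF uS uS] prd_E_uv[of l 1 0 1 0] by (simp add: f0)
  \<comment> \<open>The \<open>v m\<close> coefficient of the square of \<open>f u\<close> is
    \<open>m\<^sup>2 * b * b\<close>.\<close>
  then have "b = 0"
    using uv_eq_iff[OF m, of _ _ 0 0] m by (simp add: fu prd_E_uv)
  \<comment> \<open>Injectivity of \<open>f\<close> enters here; \<open>a\<close> is cancelled below
    to obtain \<open>d * m = l\<close>.\<close>
  have "a \<noteq> 0"
  proof
    assume "a = 0"
    then have "f u = f 0" using fu \<open>b = 0\<close> f0 by simp
    then have "u = (0 :: 'a ^ 3)" using bij uS zS by (auto simp: bij_betw_def dest: inj_onD)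
    then show False using u_nth(1) by (metis zero_index zero_neq_one)
  qed
  have "prd (E m) (f u) (f (v l)) = l *s f u"
    using mult[OF uS vS] prd_E_uv[of l 1 0 0 1] lin[of l 0] by simp
  then have "(m * (a * d)) *s u + 0 *s v m = (l * a) *s u + 0 *s v m"
    using prd_E_uv[of m a 0 c d] by (auto simp: fu fv \<open>b = 0\<close> vec.scale_scale)
  then have dm: "d * m = l"
    using uv_eq_iff[OF m, of "m * (a * d)" 0 "l * a" 0] \<open>a \<noteq> 0\<close> by (simp add: ac_simps)
  have "prd (E m) (f (v l)) (f (v l)) = (l * (l - 4)) *s f u + l\<^sup>2 *s f (v l)"
    using mult[OF vS vS] prd_E_uv[of l 0 1 0 1] lin by simp
  also have "\<dots> = (l * (l - 4) * a + l\<^sup>2 * c) *s u + (l\<^sup>2 * d) *s v m"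
    by (simp add: fu fv \<open>b = 0\<close> vec.scale_right_distrib vec.scale_left_distrib)
  \<comment> \<open>Only the coefficients of \<open>v m\<close> are compared, which eliminates the
    unknown \<open>c\<close>.\<close>
  finally have "m\<^sup>2 * d * d = l\<^sup>2 * d"
    unfolding fv prd_E_uv using uv_eq_iff[OF m] by blast
  \<comment> \<open>Since \<open>d * m = l\<close> is nonzero, so is \<open>d\<close>; cancelling it
    leaves \<open>m\<^sup>2 * d = l\<^sup>2\<close>, whose left side is
    \<open>l * m\<close>.\<close>
  then have "l * m = l * l" using dm l by (auto simp: power2_eq_square)
  then show ?thesis using l by simp
qed

theorem proposition2p4:
  fixes l m :: "'k::field"
  assumes "l \<noteq> 0" and "m \<noteq> 0"
  shows "(isomorphic (alg_square (E l)) (alg_square (E m)) \<longleftrightarrow> l = m) \<and>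
         (isomorphic (E l) (E m) \<longleftrightarrow> l = m)"
proof -
  have "algebra (E \<nu>)" for \<nu> :: 'k
    using evolution_algebra_E[of \<nu>] unfolding evolution_algebra_def by (rule conjunct1)
  then have "isomorphic (alg_square (E l)) (alg_square (E m))" if "isomorphic (E l) (E m)"
    using that alg_iso_alg_square unfolding isomorphic_def by blast
  then show ?thesis
    using isomorphic_alg_square_E_imp_eq[OF assms] isomorphic_refl by blast
qed

end
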